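(* Let $n\ge 1$ and $k\ge 0$ be integers. The map $\gamma=(\text{B-code})^{-1}\circ\text{A-code}:S_n\to S_n$ restricts to a bijection from $S(n,k)$ to $S(n,k)$ such that for every $\sigma\in S(n,k)$ $$\mathrm{inv}(\sigma)=\mathrm{sor}(\gamma(\sigma))\quad\text{and}\quad \mathrm{Rmil}(\sigma)=\mathrm{Cyc}(\gamma(\sigma)).$$
   Context: $S_n$ is the set of permutations $\sigma=\sigma_1\cdots\sigma_n$ of $[n]=\{1,\ldots,n\}$, also viewed as bijections $\sigma(i)=\sigma_i$. Products are compositions of functions taken right to left: $(\sigma\tau)(x)=\sigma(\tau(x))$. $S(n,k)=\{\sigma\in S_n:\max_i(\sigma_i-i)\le k\}$. $\mathrm{inv}(\sigma)$ is the number of pairs $i<j$ with $\sigma_i>\sigma_j$. $\mathrm{Rmil}(\sigma)=\{\sigma_i:\sigma_j>\sigma_i\text{ for all }j>i\}$ is the set of right-to-left minimum letters. $\mathrm{Cyc}(\sigma)$ is the set of minimum elements of the cycles of $\sigma$ (fixed points included). Every $\sigma\in S_n$ has a unique decomposition into transpositions $\sigma=(i_1,j_1)\cdots(i_m,j_m)$ with $j_1<\cdots<j_m$ and $i_r<j_r$ for all $r$; the sorting index is $\mathrm{sor}(\sigma)=\sum_{r=1}^m(j_r-i_r)$. $\mathrm{SE}_n$ is the set of sequences $(a_1,\ldots,a_n)$ of integers with $1\le a_i\le i$ for all $i\in[n]$. The Lehmer code of $\sigma\in S_n$ is $Leh(\sigma)=(a_1,\ldots,a_n)\in\mathrm{SE}_n$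 with $a_i=|\{j:1\le j\le i,\ \sigma_j\le\sigma_i\}|$. The A-code is $\text{A-code}(\sigma)=Leh(\sigma^{-1})$. For $\sigma\in S_n$ and $i\in[n]$, let $k(i)$ be the smallest integer $m\ge1$ such that $\sigma^{-m}(i)\le i$; then $\text{B-code}(\sigma)=(b_1,\ldots,b_n)$ with $b_i=\sigma^{-k(i)}(i)$. Both $\text{A-code}$ and $\text{B-code}$ are bijections from $S_n$ to $\mathrm{SE}_n$ (Foata and Han). *)

theory Defs
  imports "HOL-Combinatorics.Combinatorics" "HOL-Library.FuncSet"
begin

definition Sym :: "nat \<Rightarrow> (nat \<Rightarrow> nat) set" where
  "Sym n = {\<sigma>. \<sigma> permutes {1..n}}"

(* The differences are taken in int because they may be negative.
   Max is meaningful only for n \<ge> 1. *)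
definition Sym_bounded :: "nat \<Rightarrow> nat \<Rightarrow> (nat \<Rightarrow> nat) set" where
  "Sym_bounded n k = {\<sigma> \<in> Sym n. Max ((\<lambda>i. int (\<sigma> i) - int i) ` {1..n}) \<le> int k}"

definition inversion_number :: "nat \<Rightarrow> (nat \<Rightarrow> nat) \<Rightarrow> nat" where
  "inversion_number n \<sigma> =
     card {(i, j). i \<in> {1..n} \<and> j \<in> {1..n} \<and> i < j \<and> \<sigma> i > \<sigma> j}"

definition Rmil :: "nat \<Rightarrow> (nat \<Rightarrow> nat) \<Rightarrow> nat set" where
  "Rmil n \<sigma> = {\<sigma> i | i. i \<in> {1..n} \<and> (\<forall>j\<in>{1..n}. j > i \<longrightarrow> \<sigma> j > \<sigma> i)}"

(* For a permutation of a finite set, orbit \<sigma> i is the support of the cycle containing i,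
   and equals {i} when i is a fixed point. *)
definition Cyc :: "nat \<Rightarrow> (nat \<Rightarrow> nat) \<Rightarrow> nat set" where
  "Cyc n \<sigma> = {Min (orbit \<sigma> i) | i. i \<in> {1..n}}"

(* The list [(i_1, j_1), ..., (i_m, j_m)] encodes the product (i_1 j_1) ... (i_m j_m),
   composed as functions from right to left. *)
definition transposition_product :: "(nat \<times> nat) list \<Rightarrow> nat \<Rightarrow> nat" where
  "transposition_product ts = foldr (\<lambda>(i, j) \<tau>. transpose i j \<circ> \<tau>) ts id"

definition sorting_decomposition :: "nat \<Rightarrow> (nat \<Rightarrow> nat) \<Rightarrow> (nat \<times> nat) list \<Rightarrow> bool" where
  "sorting_decomposition n \<sigma> ts \<longleftrightarrow>
     (\<forall>(i, j)\<in>set ts. i \<in> {1..n} \<and> j \<in> {1..n} \<and> i < j) \<and>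
     sorted_wrt (<) (map snd ts) \<and>
     \<sigma> = transposition_product ts"

(* Every element of Sym n has exactly one sorting decomposition.
   The truncated subtraction is harmless since i < j for each entry (i, j). *)
definition sorting_index :: "nat \<Rightarrow> (nat \<Rightarrow> nat) \<Rightarrow> nat" where
  "sorting_index n \<sigma> = (\<Sum>(i, j)\<leftarrow>(THE ts. sorting_decomposition n \<sigma> ts). j - i)"

(* Sequences (a_1, ..., a_n) are functions on {1..n}, extended by undefined outside. *)
definition SE :: "nat \<Rightarrow> (nat \<Rightarrow> nat) set" where
  "SE n = (\<Pi>\<^sub>E i\<in>{1..n}. {1..i})"

definition Leh :: "nat \<Rightarrow> (nat \<Rightarrow> nat) \<Rightarrow> nat \<Rightarrow> nat" where
  "Leh n \<sigma> = (\<lambda>i\<in>{1..n}. card {j. 1 \<le> j \<and> j \<le> i \<and> \<sigma> j \<le> \<sigma> i})"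

definition A_code :: "nat \<Rightarrow> (nat \<Rightarrow> nat) \<Rightarrow> nat \<Rightarrow> nat" where
  "A_code n \<sigma> = Leh n (inv \<sigma>)"

definition B_index :: "(nat \<Rightarrow> nat) \<Rightarrow> nat \<Rightarrow> nat" where
  "B_index \<sigma> i = (LEAST m. m \<ge> 1 \<and> (inv \<sigma> ^^ m) i \<le> i)"

definition B_code :: "nat \<Rightarrow> (nat \<Rightarrow> nat) \<Rightarrow> nat \<Rightarrow> nat" where
  "B_code n \<sigma> = (\<lambda>i\<in>{1..n}. (inv \<sigma> ^^ B_index \<sigma> i) i)"

(* By Foata and Han, A_code n and B_code n are bijections from Sym n to SE n,
   so inv_into (Sym n) (B_code n) is the inverse bijection from SE n to Sym n. *)
definition gamma_map :: "nat \<Rightarrow> (nat \<Rightarrow> nat) \<Rightarrow> (nat \<Rightarrow> nat)" where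
  "gamma_map n = inv_into (Sym n) (B_code n) \<circ> A_code n"

end

(* The B-code (b_i) of sigma is read off the factorisation
   sigma = (b_1 1)(b_2 2)...(b_n n): multiplying by (b_n n) on the right removes n from its cycle and
   leaves the other first returns unchanged. Hence sor = sum (i - b_i), and i is the minimum of its cycle
   iff b_i = i. Dually, i - a_i counts the smaller letters to the right of the letter i, so the A-code
   has inv = sum (i - a_i), and i is a right-to-left minimum iff a_i = i. Finally, either code c
   of sigma satisfies i <= c_i + k for all i iff sigma lies in S(n,k), so both codes map S(n,k) onto
   the same set of sequences. *)

theory Submission
  imports Defs
begin

section \<open>Code sequences\<close>

text \<open>The common target: for \<open>n \<ge> 1\<close> both codes carry
  \<open>Sym_bounded n k\<close> onto this set.\<close>

definition SE_bounded :: "nat \<Rightarrow> nat \<Rightarrow> (nat \<Rightarrow> nat) set" where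
  "SE_bounded n k = {a \<in> SE n. \<forall>i\<in>{1..n}. i \<le> a i + k}"

lemma finite_SE: "finite (SE n)"
  by (simp add: SE_def finite_PiE)

lemma card_Sym_eq_card_SE: "card (Sym n) = card (SE n)"
  by (simp add: Sym_def SE_def card_permutations[OF refl] card_PiE fact_prod)

text \<open>Both sets have n! elements, so an injection between them is onto.\<close>

lemma bij_betw_Sym_SE:
  assumes "inj_on f (Sym n)" "f ` Sym n \<subseteq> SE n"
  shows "bij_betw f (Sym n) (SE n)"
  using assms card_image[OF assms(1)] card_subset_eq[OF finite_SE assms(2)]
  by (simp add: bij_betw_def card_Sym_eq_card_SE)

text \<open>Substituting \<open>j = \<sigma> i\<close> moves the bound to
  \<open>inv \<sigma>\<close>, the function from which both codes are computed.\<close>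

lemma Sym_bounded_iff:
  assumes "n \<ge> 1"
  shows "\<sigma> \<in> Sym_bounded n k \<longleftrightarrow> \<sigma> permutes {1..n} \<and> (\<forall>j\<in>{1..n}. j \<le> inv \<sigma> j + k)"
proof -
  have "(\<forall>i\<in>{1..n}. int (\<sigma> i) - int i \<le> int k) \<longleftrightarrow> (\<forall>j\<in>{1..n}. j \<le> inv \<sigma> j + k)"
    if p: "\<sigma> permutes {1..n}"
  proof -
    have "(\<forall>j\<in>{1..n}. j \<le> inv \<sigma> j + k) \<longleftrightarrow> (\<forall>j\<in>\<sigma> ` {1..n}. j \<le> inv \<sigma> j + k)"
      by (simp only: permutes_image[OF p])
    also have "\<dots> \<longleftrightarrow> (\<forall>i\<in>{1..n}. \<sigma> i \<le> i + k)"
      by (simp add: permutes_inverses[OF p])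
    finally show ?thesis by (simp only: diff_le_eq of_nat_add[symmetric] of_nat_le_iff add.commute)
  qed
  then show ?thesis
    using assms by (auto simp: Sym_bounded_def Sym_def)
qed

section \<open>The Lehmer code\<close>

lemma Leh_in_SE: "Leh n \<tau> \<in> SE n"
proof -
  have "card {j. 1 \<le> j \<and> j \<le> i \<and> \<tau> j \<le> \<tau> i} \<in> {1..i}" if "1 \<le> i" for i
  proof -
    have fin: "finite {j. 1 \<le> j \<and> j \<le> i \<and> \<tau> j \<le> \<tau> i}"
      by (rule finite_subset[of _ "{1..i}"]) auto
    have "card {j. 1 \<le> j \<and> j \<le> i \<and> \<tau> j \<le> \<tau> i} \<le> card {1..i}"
      by (rule card_mono) auto
    moreover have "card {j. 1 \<le> j \<and> j \<le> i \<and> \<tau> j \<le> \<tau> i} > 0"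
      using fin that by (auto simp: card_gt_0_iff)
    ultimately show ?thesis by simp
  qed
  then show ?thesis by (auto simp: SE_def Leh_def)
qed

text \<open>The two counted sets partition \<open>{1..i}\<close>. For
  \<open>\<tau> = inv \<sigma>\<close> the second one consists of the letters smaller than
  \<open>i\<close> that stand to its right in \<open>\<sigma>\<close>.\<close>

lemma Leh_complement:
  assumes "i \<in> {1..n}"
  shows "Leh n \<tau> i + card {j\<in>{1..i}. \<tau> j > \<tau> i} = i"
proof -
  have "card {j. 1 \<le> j \<and> j \<le> i \<and> \<tau> j \<le> \<tau> i} + card {j\<in>{1..i}. \<tau> j > \<tau> i}
      = card ({j. 1 \<le> j \<and> j \<le> i \<and> \<tau> j \<le> \<tau> i} \<union> {j\<in>{1..i}. \<tau> j > \<tau> i})"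
    by (rule card_Un_disjoint[symmetric]) (auto intro: finite_subset[of _ "{1..i}"])
  also have "{j. 1 \<le> j \<and> j \<le> i \<and> \<tau> j \<le> \<tau> i} \<union> {j\<in>{1..i}. \<tau> j > \<tau> i} = {1..i}"
    by auto
  finally show ?thesis using assms by (simp add: Leh_def)
qed

section \<open>Recovering a permutation from its Lehmer code\<close>

text \<open>The sublevel sets of \<open>f\<close> form a chain, and if \<open>y < f x\<close> the
  inclusion is strict because \<open>x\<close> lies in only one of them. So comparing ranks amounts
  to comparing values.\<close>

lemma rank_le_iff:
  fixes f :: "'a \<Rightarrow> 'b :: linorder"
  assumes "finite S" "x \<in> S"
  shows "card {l\<in>S. f l \<le> f x} \<le> card {l\<in>S. f l \<le> y} \<longleftrightarrow> f x \<le> y"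
proof
  assume "f x \<le> y"
  then show "card {l\<in>S. f l \<le> f x} \<le> card {l\<in>S. f l \<le> y}"
    using assms by (intro card_mono) auto
next
  assume le: "card {l\<in>S. f l \<le> f x} \<le> card {l\<in>S. f l \<le> y}"
  show "f x \<le> y"
  proof (rule ccontr)
    assume "\<not> f x \<le> y"
    then have "{l\<in>S. f l \<le> y} \<subset> {l\<in>S. f l \<le> f x}"
      using assms by auto
    then have "card {l\<in>S. f l \<le> y} < card {l\<in>S. f l \<le> f x}"
      using assms by (intro psubset_card_mono) auto
    with le show False by simp
  qed
qed

text \<open>Induction on the length \<open>m\<close> of the prefix: the next code entry is the rank
  of the new value among the earlier ones, and this rank fixes its position relative to each of
  them.\<close>

lemma Leh_eq_imp_same_order:
  assumes "inj_on \<sigma> {1..n}" "inj_on \<tau> {1..n}" "\<And>i. i \<in> {1..n} \<Longrightarrow> Leh n \<sigma> i = Leh n \<tau> i"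
    and "i \<in> {1..n}" "j \<in> {1..n}"
  shows "\<sigma> i \<le> \<sigma> j \<longleftrightarrow> \<tau> i \<le> \<tau> j"
proof -
  have "\<forall>i\<in>{1..m}. \<forall>j\<in>{1..m}. \<sigma> i \<le> \<sigma> j \<longleftrightarrow> \<tau> i \<le> \<tau> j" if "m \<le> n" for m
    using that
  proof (induction m)
    case (Suc m)
    have IH: "\<sigma> i \<le> \<sigma> j \<longleftrightarrow> \<tau> i \<le> \<tau> j" if "i \<in> {1..m}" "j \<in> {1..m}" for i j
      using Suc that by simp
    \<comment> \<open>The outer \<open>Suc\<close> appears because a position counts itself in its
      own code entry.\<close>
    have code: "Leh n \<upsilon> (Suc m) = Suc (card {l\<in>{1..m}. \<upsilon> l \<le> \<upsilon> (Suc m)})" for \<upsilon>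
    proof -
      have "{j. 1 \<le> j \<and> j \<le> Suc m \<and> \<upsilon> j \<le> \<upsilon> (Suc m)}
          = insert (Suc m) {l\<in>{1..m}. \<upsilon> l \<le> \<upsilon> (Suc m)}"
        by (auto simp: le_Suc_eq)
      then show ?thesis using Suc.prems by (simp add: Leh_def)
    qed
    have rank: "card {l\<in>{1..m}. \<sigma> l \<le> \<sigma> (Suc m)} = card {l\<in>{1..m}. \<tau> l \<le> \<tau> (Suc m)}"
      using assms(3)[of "Suc m"] Suc.prems code[of \<sigma>] code[of \<tau>] by simp
    have left: "\<sigma> x \<le> \<sigma> (Suc m) \<longleftrightarrow> \<tau> x \<le> \<tau> (Suc m)" if x: "x \<in> {1..m}" for x
    proof -
      have "{l\<in>{1..m}. \<sigma> l \<le> \<sigma> x} = {l\<in>{1..m}. \<tau> l \<le> \<tau> x}"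
        using IH x by blast
      then show ?thesis
        using rank_le_iff[of "{1..m}" x \<sigma> "\<sigma> (Suc m)"] rank_le_iff[of "{1..m}" x \<tau> "\<tau> (Suc m)"] rank x
        by simp
    qed
    have neq: "\<sigma> x \<noteq> \<sigma> (Suc m)" "\<tau> x \<noteq> \<tau> (Suc m)" if "x \<in> {1..m}" for x
      using that Suc.prems assms(1,2)
        inj_on_eq_iff[OF assms(1), of x "Suc m"] inj_on_eq_iff[OF assms(2), of x "Suc m"] by auto
    have right: "\<sigma> (Suc m) \<le> \<sigma> x \<longleftrightarrow> \<tau> (Suc m) \<le> \<tau> x" if x: "x \<in> {1..m}" for x
      using left[OF x] neq[OF x] by linarith
    have "{1..Suc m} = insert (Suc m) {1..m}" by auto
    then show ?case using IH left right by simp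
  qed simp
  then show ?thesis using assms(4,5) by blast
qed

text \<open>\<open>\<tau>\<close> maps the counted set bijectively onto \<open>{1..v}\<close>. With
  \<open>v = \<tau> i\<close>, each value is recovered as its own rank, hence from the relative
  order alone.\<close>

lemma card_permutes_le:
  assumes "\<tau> permutes {1..n}" "v \<le> n"
  shows "card {l\<in>{1..n}. \<tau> l \<le> v} = v"
proof -
  have "\<tau> ` {l\<in>{1..n}. \<tau> l \<le> v} = {x \<in> \<tau> ` {1..n}. x \<le> v}" by auto
  also have "\<dots> = {1..v}" unfolding permutes_image[OF assms(1)] using assms(2) by auto
  finally show ?thesis
    using card_image[OF inj_on_subset[OF permutes_inj[OF assms(1)] subset_UNIV], of "{l\<in>{1..n}. \<tau> l \<le> v}"]
    by simp
qed

lemma inj_on_Leh: "inj_on (Leh n) (Sym n)"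
proof (rule inj_onI)
  fix \<sigma> \<tau> assume "\<sigma> \<in> Sym n" "\<tau> \<in> Sym n" and eq: "Leh n \<sigma> = Leh n \<tau>"
  then have p: "\<sigma> permutes {1..n}" "\<tau> permutes {1..n}" by (auto simp: Sym_def)
  show "\<sigma> = \<tau>"
  proof
    fix i
    show "\<sigma> i = \<tau> i"
    proof (cases "i \<in> {1..n}")
      case True
      have "{l\<in>{1..n}. \<sigma> l \<le> \<sigma> i} = {l\<in>{1..n}. \<tau> l \<le> \<tau> i}"
        using Leh_eq_imp_same_order[OF permutes_inj_on[OF p(1)] permutes_inj_on[OF p(2)] _ _ True]
        unfolding eq by blast
      moreover have "\<sigma> i \<le> n" "\<tau> i \<le> n"
        using True permutes_in_image[OF p(1), of i] permutes_in_image[OF p(2), of i] by auto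
      ultimately show ?thesis
        using card_permutes_le[OF p(1), of "\<sigma> i"] card_permutes_le[OF p(2), of "\<tau> i"] by metis
    next
      case False
      then show ?thesis using p by (simp add: permutes_not_in)
    qed
  qed
qed

lemma bij_betw_A_code: "bij_betw (A_code n) (Sym n) (SE n)"
proof (rule bij_betw_Sym_SE)
  show "inj_on (A_code n) (Sym n)"
  proof (rule inj_onI)
    fix \<sigma> \<tau> assume *: "\<sigma> \<in> Sym n" "\<tau> \<in> Sym n" "A_code n \<sigma> = A_code n \<tau>"
    then have "inv \<sigma> = inv \<tau>"
      using inj_onD[OF inj_on_Leh, of n "inv \<sigma>" "inv \<tau>"]
      by (auto simp: A_code_def Sym_def permutes_inv)
    then show "\<sigma> = \<tau>" using * by (metis Sym_def mem_Collect_eq permutes_inv_inv)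
  qed
qed (auto simp: A_code_def Leh_in_SE)

section \<open>Bound, inversions and right-to-left minima from the A-code\<close>

text \<open>Forwards, the code entry counts only some of the \<open>\<tau> i\<close> positions with
  value at most \<open>\<tau> i\<close>. Backwards, the bound at every position forces all
  \<open>i - k\<close> positions with value at most \<open>i - k\<close> into \<open>{1..i}\<close>,
  where the code entry counts them.\<close>

lemma Leh_bounded_iff:
  assumes p: "\<tau> permutes {1..n}"
  shows "(\<forall>i\<in>{1..n}. i \<le> Leh n \<tau> i + k) \<longleftrightarrow> (\<forall>i\<in>{1..n}. i \<le> \<tau> i + k)"
proof (intro iffI ballI)
  fix i assume *: "\<forall>i\<in>{1..n}. i \<le> Leh n \<tau> i + k" and i: "i \<in> {1..n}"
  have "Leh n \<tau> i \<le> card {l\<in>{1..n}. \<tau> l \<le> \<tau> i}"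
    using i by (auto simp: Leh_def intro!: card_mono)
  also have "\<dots> = \<tau> i"
    using permutes_in_image[OF p, of i] i by (intro card_permutes_le[OF p]) auto
  finally show "i \<le> \<tau> i + k" using * i by fastforce
next
  fix i assume *: "\<forall>i\<in>{1..n}. i \<le> \<tau> i + k" and i: "i \<in> {1..n}"
  have "i - k = card {l\<in>{1..n}. \<tau> l \<le> i - k}"
    using i by (intro card_permutes_le[OF p, symmetric]) auto
  also have "\<dots> \<le> card {j. 1 \<le> j \<and> j \<le> i \<and> \<tau> j \<le> \<tau> i}"
  proof (rule card_mono)
    show "{l\<in>{1..n}. \<tau> l \<le> i - k} \<subseteq> {j. 1 \<le> j \<and> j \<le> i \<and> \<tau> j \<le> \<tau> i}"
    proof
      fix l assume l: "l \<in> {l\<in>{1..n}. \<tau> l \<le> i - k}"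
      \<comment> \<open>This makes the truncated difference \<open>i - k\<close> positive, so
        \<open>l \<le> \<tau> l + k \<le> i\<close>.\<close>
      then have "1 \<le> \<tau> l" using permutes_in_image[OF p, of l] by auto
      moreover have "l \<le> \<tau> l + k" "i \<le> \<tau> i + k" using * l i by auto
      ultimately show "l \<in> {j. 1 \<le> j \<and> j \<le> i \<and> \<tau> j \<le> \<tau> i}" using l by auto
    qed
  qed (auto intro: finite_subset[of _ "{1..i}"])
  finally show "i \<le> Leh n \<tau> i + k" using i by (simp add: Leh_def)
qed

text \<open>Each inversion is replaced by its pair of letters, and the pairs are grouped by the
  larger letter \<open>v\<close>; \<open>Leh_complement\<close> gives the size of each
  group.\<close>

lemma inversion_number_eq_sum_A_code:
  assumes p: "\<sigma> permutes {1..n}"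
  shows "inversion_number n \<sigma> = (\<Sum>i\<in>{1..n}. i - A_code n \<sigma> i)"
proof -
  let ?I = "{(i, j). i \<in> {1..n} \<and> j \<in> {1..n} \<and> i < j \<and> \<sigma> i > \<sigma> j}"
  let ?J = "SIGMA v:{1..n}. {w\<in>{1..v}. inv \<sigma> w > inv \<sigma> v}"
  note [simp] = permutes_inverses[OF p]
  have im: "\<sigma> i \<in> {1..n} \<longleftrightarrow> i \<in> {1..n}" "inv \<sigma> i \<in> {1..n} \<longleftrightarrow> i \<in> {1..n}" for i
    using permutes_in_image[OF p] permutes_in_image[OF permutes_inv[OF p]] by blast+
  have "bij_betw (\<lambda>(i, j). (\<sigma> i, \<sigma> j)) ?I ?J"
  proof (rule bij_betw_byWitness[where f' = "\<lambda>(v, w). (inv \<sigma> v, inv \<sigma> w)"])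
    show "(\<lambda>(i, j). (\<sigma> i, \<sigma> j)) ` ?I \<subseteq> ?J"
      using im(1) by fastforce
    show "(\<lambda>(v, w). (inv \<sigma> v, inv \<sigma> w)) ` ?J \<subseteq> ?I"
    proof (rule image_subsetI)
      fix x assume "x \<in> ?J"
      then obtain v w where x: "x = (v, w)"
        and h: "v \<in> {1..n}" "w \<in> {1..n}" "w \<le> v" "inv \<sigma> v < inv \<sigma> w"
        by auto
      then have "w < v" by (cases "w = v") auto
      then show "(case x of (v, w) \<Rightarrow> (inv \<sigma> v, inv \<sigma> w)) \<in> ?I"
        using x h im(2)[of v] im(2)[of w] by simp
    qed
  qed auto
  then have "inversion_number n \<sigma> = card ?J"
    unfolding inversion_number_def by (rule bij_betw_same_card)
  also have "\<dots> = (\<Sum>v\<in>{1..n}. card {w\<in>{1..v}. inv \<sigma> w > inv \<sigma> v})"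
    by (rule card_SigmaI) auto
  also have "\<dots> = (\<Sum>i\<in>{1..n}. i - A_code n \<sigma> i)"
  proof (rule sum.cong)
    fix v assume "v \<in> {1..n}"
    from Leh_complement[OF this, of "inv \<sigma>"]
    show "card {w\<in>{1..v}. inv \<sigma> w > inv \<sigma> v} = v - A_code n \<sigma> v"
      by (simp add: A_code_def)
  qed simp
  finally show ?thesis .
qed

text \<open>By \<open>Leh_complement\<close>, the entry at \<open>v\<close> equals \<open>v\<close>
  exactly when no smaller letter stands to the right of \<open>v\<close>; the rest passes between
  letters and positions.\<close>

lemma Rmil_eq_A_code:
  assumes p: "\<sigma> permutes {1..n}"
  shows "Rmil n \<sigma> = {i\<in>{1..n}. A_code n \<sigma> i = i}"
proof -
  have "A_code n \<sigma> v = v \<longleftrightarrow> (\<forall>j\<in>{1..n}. j > inv \<sigma> v \<longrightarrow> \<sigma> j > v)" if v: "v \<in> {1..n}" for v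
  proof -
    have "A_code n \<sigma> v = v \<longleftrightarrow> card {w\<in>{1..v}. inv \<sigma> w > inv \<sigma> v} = 0"
      using Leh_complement[OF v, of "inv \<sigma>"] unfolding A_code_def by linarith
    also have "\<dots> \<longleftrightarrow> (\<forall>w\<in>{1..n}. inv \<sigma> w > inv \<sigma> v \<longrightarrow> w > v)"
      using v by (auto simp: not_less) (meson leD not_le_imp_less)
    also have "\<dots> \<longleftrightarrow> (\<forall>w\<in>\<sigma> ` {1..n}. inv \<sigma> w > inv \<sigma> v \<longrightarrow> w > v)"
      by (simp only: permutes_image[OF p])
    finally show ?thesis by (simp add: permutes_inverses[OF p])
  qed
  moreover have "Rmil n \<sigma> = {v \<in> \<sigma> ` {1..n}. \<forall>j\<in>{1..n}. j > inv \<sigma> v \<longrightarrow> \<sigma> j > v}"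
    by (auto simp: Rmil_def permutes_inverses[OF p])
  ultimately show ?thesis unfolding permutes_image[OF p] by blast
qed

section \<open>First returns and the B-code\<close>

text \<open>An inductive form of the search behind \<open>B_index\<close>, which allows induction
  along the path. The start \<open>y\<close> is separate from the threshold \<open>i\<close> because
  it moves while \<open>i\<close> stays. At least one step is taken, matching
  \<open>m \<ge> 1\<close> there.\<close>

inductive first_return :: "(nat \<Rightarrow> nat) \<Rightarrow> nat \<Rightarrow> nat \<Rightarrow> nat \<Rightarrow> bool"
  for \<rho> :: "nat \<Rightarrow> nat" and i :: nat where
  stop: "\<rho> y \<le> i \<Longrightarrow> first_return \<rho> i y (\<rho> y)"
| skip: "\<rho> y > i \<Longrightarrow> first_return \<rho> i (\<rho> y) x \<Longrightarrow> first_return \<rho> i y x"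

lemma first_return_le: "first_return \<rho> i y x \<Longrightarrow> x \<le> i"
  by (induction rule: first_return.induct) auto

lemma first_return_unique:
  "first_return \<rho> i y x \<Longrightarrow> first_return \<rho> i y x' \<Longrightarrow> x = x'"
proof (induction rule: first_return.induct)
  case (stop y)
  from stop(2,1) show ?case by cases auto
next
  case (skip y x)
  from skip(4,1) show ?case by cases (use skip.IH in auto)
qed

lemma first_return_funpow_iff:
  "first_return \<rho> i y x \<longleftrightarrow>
    (\<exists>m\<ge>1. (\<rho> ^^ m) y = x \<and> x \<le> i \<and> (\<forall>l. 1 \<le> l \<and> l < m \<longrightarrow> (\<rho> ^^ l) y > i))"
proof
  assume "first_return \<rho> i y x"
  then show "\<exists>m\<ge>1. (\<rho> ^^ m) y = x \<and> x \<le> i \<and> (\<forall>l. 1 \<le> l \<and> l < m \<longrightarrow> (\<rho> ^^ l) y > i)"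
  proof (induction rule: first_return.induct)
    case (stop y)
    then show ?case by (intro exI[of _ 1]) auto
  next
    case (skip y x)
    then obtain m where m: "m \<ge> 1" "(\<rho> ^^ m) (\<rho> y) = x" "x \<le> i"
      "\<forall>l. 1 \<le> l \<and> l < m \<longrightarrow> (\<rho> ^^ l) (\<rho> y) > i" by blast
    have "(\<rho> ^^ l) y > i" if "1 \<le> l" "l < Suc m" for l
    proof (cases "l = 1")
      case False
      then obtain l' where "l = Suc l'" "1 \<le> l'" "l' < m"
        using \<open>1 \<le> l\<close> \<open>l < Suc m\<close> by (cases l) auto
      then show ?thesis using m(4) by (simp add: funpow_swap1)
    qed (use skip in simp)
    then show ?case using m by (intro exI[of _ "Suc m"]) (auto simp: funpow_swap1)
  qed
next
  have "first_return \<rho> i y ((\<rho> ^^ Suc m) y)"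
    if "(\<rho> ^^ Suc m) y \<le> i" "\<forall>l. 1 \<le> l \<and> l < Suc m \<longrightarrow> (\<rho> ^^ l) y > i" for m
    using that
  proof (induction m arbitrary: y)
    case 0
    then show ?case using first_return.stop[of \<rho> y i] by simp
  next
    case (Suc m)
    have "\<forall>l. 1 \<le> l \<and> l < Suc m \<longrightarrow> (\<rho> ^^ l) (\<rho> y) > i"
    proof (intro allI impI)
      fix l assume "1 \<le> l \<and> l < Suc m"
      then show "(\<rho> ^^ l) (\<rho> y) > i" using Suc.prems(2)[rule_format, of "Suc l"]
        by (simp add: funpow_swap1)
    qed
    then have "first_return \<rho> i (\<rho> y) ((\<rho> ^^ Suc m) (\<rho> y))"
      using Suc.prems(1) by (intro Suc.IH) (auto simp: funpow_swap1)
    moreover have "\<rho> y > i" using Suc.prems(2)[rule_format, of 1] by simp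
    ultimately show ?case using first_return.skip[of i \<rho> y] by (simp add: funpow_swap1)
  qed
  then show "first_return \<rho> i y x"
    if "\<exists>m\<ge>1. (\<rho> ^^ m) y = x \<and> x \<le> i \<and> (\<forall>l. 1 \<le> l \<and> l < m \<longrightarrow> (\<rho> ^^ l) y > i)"
    using that by (metis Suc_pred less_eq_Suc_le One_nat_def)
qed

text \<open>A permutation of a finite set brings \<open>i\<close> back to itself after a positive
  number of steps, so the \<open>LEAST\<close> in \<open>B_index\<close> is attained.\<close>

lemma first_return_B_code:
  assumes p: "\<sigma> permutes {1..n}" and i: "i \<in> {1..n}"
  shows "first_return (inv \<sigma>) i i (B_code n \<sigma> i)"
proof -
  let ?P = "\<lambda>m. m \<ge> 1 \<and> (inv \<sigma> ^^ m) i \<le> i"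
  have "permutation (inv \<sigma>)"
    using permutes_inv[OF p] by (intro permutes_imp_permutation) auto
  then have "i \<in> orbit (inv \<sigma>) i" by (rule permutation_self_in_orbit)
  then obtain m where "m > 0" "(inv \<sigma> ^^ m) i = i" by (auto simp: orbit_altdef)
  then have "?P m" by simp
  then have "?P (B_index \<sigma> i)" unfolding B_index_def by (rule LeastI)
  moreover have "(inv \<sigma> ^^ l) i > i" if "1 \<le> l" "l < B_index \<sigma> i" for l
    using not_less_Least[of l ?P] that unfolding B_index_def by auto
  ultimately show ?thesis
    unfolding first_return_funpow_iff using i
    by (intro exI[of _ "B_index \<sigma> i"]) (auto simp: B_code_def)
qed

lemma B_code_eqI:
  assumes "\<sigma> permutes {1..n}" "i \<in> {1..n}" "first_return (inv \<sigma>) i i x"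
  shows "B_code n \<sigma> i = x"
  using first_return_B_code[OF assms(1,2)] assms(3) by (rule first_return_unique)

lemma first_return_in_orbit: "first_return \<rho> i y x \<Longrightarrow> x \<in> orbit \<rho> y"
  by (auto simp: first_return_funpow_iff orbit_altdef)

lemma B_code_in_SE:
  assumes p: "\<sigma> permutes {1..n}"
  shows "B_code n \<sigma> \<in> SE n"
proof -
  have "B_code n \<sigma> i \<in> {1..i}" if i: "i \<in> {1..n}" for i
  proof -
    have "B_code n \<sigma> i \<in> {1..n}"
      using permutes_orbit_subset[OF permutes_inv[OF p] i]
        first_return_in_orbit[OF first_return_B_code[OF p i]] by blast
    then show ?thesis using first_return_le[OF first_return_B_code[OF p i]] by simp
  qed
  then show ?thesis by (auto simp: SE_def B_code_def)
qed

section \<open>Bound and cycle minima from the B-code\<close>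

text \<open>Forwards, either \<open>inv \<sigma> i > i\<close> and the bound is trivial, or the path
  stops at once and the code entry is \<open>inv \<sigma> i\<close>. Backwards, every point
  \<open>y\<close> before the end of the path is at least \<open>i\<close>, so the bound for its
  last step suffices.\<close>

lemma B_code_bounded_iff:
  assumes p: "\<sigma> permutes {1..n}"
  shows "(\<forall>i\<in>{1..n}. i \<le> B_code n \<sigma> i + k) \<longleftrightarrow> (\<forall>i\<in>{1..n}. i \<le> inv \<sigma> i + k)"
proof (intro iffI ballI)
  fix i assume *: "\<forall>i\<in>{1..n}. i \<le> B_code n \<sigma> i + k" and i: "i \<in> {1..n}"
  show "i \<le> inv \<sigma> i + k"
  proof (cases "inv \<sigma> i \<le> i")
    case True
    then have "B_code n \<sigma> i = inv \<sigma> i"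
      by (intro B_code_eqI[OF p i] first_return.stop)
    then show ?thesis using * i by metis
  qed simp
next
  fix i assume *: "\<forall>i\<in>{1..n}. i \<le> inv \<sigma> i + k" and i: "i \<in> {1..n}"
  have "i \<le> x + k" if "first_return (inv \<sigma>) i y x" "i \<le> y" "y \<in> {1..n}" for y x
    using that
  proof (induction rule: first_return.induct)
    case (stop y)
    then have "y \<le> inv \<sigma> y + k" using * by blast
    then show ?case using stop by linarith
  next
    case (skip y x)
    then show ?case using permutes_in_image[OF permutes_inv[OF p], of y] by simp
  qed
  from this[OF first_return_B_code[OF p i]] i show "i \<le> B_code n \<sigma> i + k" by simp
qed

text \<open>A first return from \<open>i\<close> to \<open>i\<close> traverses the whole cycle with
  all other points above \<open>i\<close>. Conversely, the code entry lies in the cycle and is at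
  most \<open>i\<close>, so it equals a minimal \<open>i\<close>.\<close>

lemma Cyc_eq_B_code:
  assumes p: "\<sigma> permutes {1..n}"
  shows "Cyc n \<sigma> = {i\<in>{1..n}. B_code n \<sigma> i = i}"
proof -
  have perm: "permutation \<sigma>" using p by (intro permutes_imp_permutation) auto
  have orb: "orbit \<sigma> i \<subseteq> {1..n}" if "i \<in> {1..n}" for i
    using permutes_orbit_subset[OF p that] .
  have fin: "finite (orbit \<sigma> i)" for i
    using perm permutation_self_in_orbit finite_orbit by metis
  have self: "i \<in> orbit \<sigma> i" for i
    using perm by (rule permutation_self_in_orbit)
  have "B_code n \<sigma> i = i \<longleftrightarrow> (\<forall>x\<in>orbit \<sigma> i. i \<le> x)" if i: "i \<in> {1..n}" for i
  proof
    assume eq: "B_code n \<sigma> i = i"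
    obtain m where m: "m \<ge> 1" "(inv \<sigma> ^^ m) i = i"
      and above: "\<forall>l. 1 \<le> l \<and> l < m \<longrightarrow> (inv \<sigma> ^^ l) i > i"
      using first_return_B_code[OF p i] unfolding eq first_return_funpow_iff by blast
    have "i \<le> (inv \<sigma> ^^ l) i" for l
    proof -
      \<comment> \<open>\<open>m\<close> is a period of \<open>i\<close>, so every exponent reduces
        to one below \<open>m\<close>, where \<open>above\<close> applies.\<close>
      have "(inv \<sigma> ^^ l) i = (inv \<sigma> ^^ (l mod m)) i" using funpow_mod_eq[OF m(2)] by simp
      moreover have "l mod m < m" using m(1) by simp
      ultimately show ?thesis
        using above by (cases "l mod m = 0") (auto simp: Suc_le_eq less_imp_le)
    qed
    then have "\<forall>x\<in>orbit (inv \<sigma>) i. i \<le> x" by (auto simp: orbit_altdef)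
    then show "\<forall>x\<in>orbit \<sigma> i. i \<le> x" by (simp add: orbit_inv_eq[OF perm])
  next
    assume "\<forall>x\<in>orbit \<sigma> i. i \<le> x"
    then have "i \<le> B_code n \<sigma> i"
      using first_return_in_orbit[OF first_return_B_code[OF p i]] orbit_inv_eq[OF perm] by auto
    then show "B_code n \<sigma> i = i"
      using first_return_le[OF first_return_B_code[OF p i]] by simp
  qed
  moreover have "Cyc n \<sigma> = {i\<in>{1..n}. \<forall>x\<in>orbit \<sigma> i. i \<le> x}"
  proof (intro equalityI subsetI)
    fix i assume "i \<in> Cyc n \<sigma>"
    then obtain j where j: "j \<in> {1..n}" "i = Min (orbit \<sigma> j)" by (auto simp: Cyc_def)
    then have mem: "i \<in> orbit \<sigma> j" using Min_in[OF fin] self by blast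
    then have "orbit \<sigma> i \<subseteq> orbit \<sigma> j" by (auto intro: orbit_trans)
    then show "i \<in> {i\<in>{1..n}. \<forall>x\<in>orbit \<sigma> i. i \<le> x}"
      using j mem orb[OF j(1)] Min_le[OF fin] by blast
  next
    fix i assume i: "i \<in> {i\<in>{1..n}. \<forall>x\<in>orbit \<sigma> i. i \<le> x}"
    then have "Min (orbit \<sigma> i) = i" using self fin by (intro Min_eqI) auto
    then show "i \<in> Cyc n \<sigma>" using i unfolding Cyc_def by (metis (mono_tags, lifting) mem_Collect_eq)
  qed
  ultimately show ?thesis by blast
qed

section \<open>Sorting decompositions\<close>

lemma transposition_product_simps [simp]:
  "transposition_product [] = id"
  "transposition_product (t # ts) = transpose (fst t) (snd t) \<circ> transposition_product ts"
  by (auto simp: transposition_product_def case_prod_beta)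

lemma transposition_product_append:
  "transposition_product (xs @ ys) = transposition_product xs \<circ> transposition_product ys"
  by (induction xs) (auto simp: comp_assoc)

lemma transposition_product_drop_trivial:
  "transposition_product (filter (\<lambda>(i, j). i \<noteq> j) ts) = transposition_product ts"
  by (induction ts) auto

lemma transposition_product_fixes:
  assumes "\<forall>(i, j)\<in>set ts. i < j \<and> j < x"
  shows "transposition_product ts x = x"
  using assms by (induction ts) (auto simp: transpose_def)

text \<open>Composing with the transposition of \<open>n\<close> and its preimage deletes \<open>n\<close> from its cycle, and first
  returns to initial segments below \<open>n\<close> do not notice this. The induction also needs paths starting
  at \<open>y = n\<close>; they become paths starting at the predecessor \<open>z\<close> of \<open>n\<close> in the shortened cycle.\<close>

lemma first_return_delete:
  assumes "first_return \<rho> i y x" "inj \<rho>" "i < n" "z \<noteq> n" "y = z \<or> y = n \<and> \<rho> z = n"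
  shows "first_return (transpose (\<rho> n) n \<circ> \<rho>) i z x"
proof -
  let ?r = "transpose (\<rho> n) n \<circ> \<rho>"
  \<comment> \<open>The transposition also moves the value \<open>\<rho> n\<close>, but by
    injectivity \<open>\<rho> z\<close> differs from it.\<close>
  have r: "?r z = (if \<rho> z = n then \<rho> n else \<rho> z)" if "z \<noteq> n" for z
    using that injD[OF assms(2), of z n] by (auto simp: transpose_def)
  show ?thesis
    using assms(1,4,5)
  proof (induction arbitrary: z rule: first_return.induct)
    case (stop y)
    then have "?r z = \<rho> y" using r[of z] \<open>i < n\<close> by (auto simp del: o_apply)
    then show ?case using stop(1) first_return.stop[of ?r z i] by (simp only:)
  next
    case (skip y x)
    show ?case
    proof (cases "\<rho> y = n")
      case True
      \<comment> \<open>The step onto \<open>n\<close> has no counterpart in the shortened cycle: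
        \<open>z\<close> stays put while the path moves on to \<open>n\<close>.\<close>
      then have "z = y" using skip.prems injD[OF assms(2), of z y] by auto
      then show ?thesis using skip.IH[of z] skip.prems True by simp
    next
      case False
      then have "?r z = \<rho> y" using r[of z] skip.prems by (auto simp del: o_apply)
      then show ?thesis
        using skip.hyps(1) skip.IH[OF False] first_return.skip[of i ?r z x] by (simp del: o_apply)
    qed
  qed
qed

lemma permutes_delete_max:
  assumes p: "\<sigma> permutes {1..Suc n}"
  shows "\<sigma> \<circ> transpose (inv \<sigma> (Suc n)) (Suc n) permutes {1..n}"
proof -
  have "inv \<sigma> (Suc n) \<in> {1..Suc n}"
    using permutes_in_image[OF permutes_inv[OF p], of "Suc n"] by simp
  then have "\<sigma> \<circ> transpose (inv \<sigma> (Suc n)) (Suc n) permutes {1..Suc n}"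
    by (intro permutes_compose[OF permutes_swap_id p]) auto
  then show ?thesis
  proof (rule permutes_superset)
    fix x assume "x \<in> {1..Suc n} - {1..n}"
    then have "x = Suc n" by auto
    then show "(\<sigma> \<circ> transpose (inv \<sigma> (Suc n)) (Suc n)) x = x"
      by (simp add: permutes_inverses[OF p])
  qed
qed

lemma B_code_delete_max:
  assumes p: "\<sigma> permutes {1..Suc n}" and i: "i \<in> {1..n}"
  shows "B_code n (\<sigma> \<circ> transpose (inv \<sigma> (Suc n)) (Suc n)) i = B_code (Suc n) \<sigma> i"
proof (rule B_code_eqI[OF permutes_delete_max[OF p] i])
  have "inv (\<sigma> \<circ> transpose (inv \<sigma> (Suc n)) (Suc n)) = transpose (inv \<sigma> (Suc n)) (Suc n) \<circ> inv \<sigma>"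
    using permutes_bij[OF p] by (simp add: o_inv_distrib)
  moreover have "first_return (inv \<sigma>) i i (B_code (Suc n) \<sigma> i)"
    using i by (intro first_return_B_code[OF p]) auto
  ultimately show "first_return (inv (\<sigma> \<circ> transpose (inv \<sigma> (Suc n)) (Suc n))) i i (B_code (Suc n) \<sigma> i)"
    using first_return_delete[of "inv \<sigma>" i i _ "Suc n" i] permutes_inj[OF permutes_inv[OF p]] i by auto
qed

text \<open>Induction strips off the last factor: it is the transposition that makes
  \<open>Suc n\<close> a fixed point, and by \<open>B_code_delete_max\<close> the shorter
  permutation keeps the other entries. As the code rebuilds \<open>\<sigma>\<close>, this also gives
  injectivity of the B-code.\<close>

lemma transposition_product_B_code:
  "\<sigma> permutes {1..n} \<Longrightarrow>
    transposition_product (map (\<lambda>j. (B_code n \<sigma> j, j)) [1..<Suc n]) = \<sigma>"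
proof (induction n arbitrary: \<sigma>)
  case 0
  then show ?case by simp
next
  case (Suc n)
  let ?t = "transpose (inv \<sigma> (Suc n)) (Suc n)"
  \<comment> \<open>No value on \<open>{1..Suc n}\<close> exceeds the threshold
    \<open>Suc n\<close>, so the path stops after one step.\<close>
  have top: "B_code (Suc n) \<sigma> (Suc n) = inv \<sigma> (Suc n)"
    using permutes_in_image[OF permutes_inv[OF Suc.prems], of "Suc n"]
    by (intro B_code_eqI[OF Suc.prems] first_return.stop) auto
  have "map (\<lambda>j. (B_code (Suc n) \<sigma> j, j)) [1..<Suc n] = map (\<lambda>j. (B_code n (\<sigma> \<circ> ?t) j, j)) [1..<Suc n]"
    by (rule map_cong) (auto simp: B_code_delete_max[OF Suc.prems])
  then have "transposition_product (map (\<lambda>j. (B_code (Suc n) \<sigma> j, j)) [1..<Suc n]) = \<sigma> \<circ> ?t"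
    using Suc.IH[OF permutes_delete_max[OF Suc.prems]] by (simp only:)
  moreover have "[1..<Suc (Suc n)] = [1..<Suc n] @ [Suc n]" by simp
  ultimately show ?case
    by (simp add: transposition_product_append top comp_assoc del: upt_Suc)
qed

lemma bij_betw_B_code: "bij_betw (B_code n) (Sym n) (SE n)"
proof (rule bij_betw_Sym_SE)
  show "inj_on (B_code n) (Sym n)"
    by (rule inj_onI) (metis Sym_def mem_Collect_eq transposition_product_B_code)
qed (auto simp: Sym_def B_code_in_SE)

text \<open>The last factor \<open>(i j)\<close> is determined by the product: \<open>j\<close> is the largest point moved, and \<open>i\<close> is
  its preimage.\<close>

lemma transposition_product_inject:
  assumes "\<forall>(i, j)\<in>set ts. i < j" "sorted_wrt (<) (map snd ts)"
    and "\<forall>(i, j)\<in>set us. i < j" "sorted_wrt (<) (map snd us)"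
    and "transposition_product ts = transposition_product us"
  shows "ts = us"
  using assms
proof (induction ts arbitrary: us rule: rev_induct)
  case Nil
  show ?case
  proof (cases us rule: rev_cases)
    case (snoc us' t)
    obtain i j where t: "t = (i, j)" by (cases t)
    \<comment> \<open>The last factor acts first and sends \<open>i\<close> to \<open>j\<close>; the
      others involve only points below \<open>j\<close>, so they fix \<open>j\<close>.\<close>
    have "transposition_product us i = j"
      using Nil snoc t
      by (auto simp: transposition_product_append sorted_wrt_append intro!: transposition_product_fixes)
    moreover have "transposition_product us i = i"
      using Nil(5) by (metis id_apply transposition_product_simps(1))
    moreover have "i < j" using Nil snoc t by auto
    ultimately show ?thesis by simp
  qed simp
next
  case (snoc t ts)
  have last: "transposition_product (vs @ [(i, j)]) i = j \<and> i < j
      \<and> (\<forall>x>j. transposition_product (vs @ [(i, j)]) x = x)"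
    if "\<forall>(i, j)\<in>set (vs @ [(i, j)]). i < j" "sorted_wrt (<) (map snd (vs @ [(i, j)]))" for vs i j
  proof -
    have "\<forall>(i', j')\<in>set vs. i' < j' \<and> j' < j" "i < j"
      using that by (auto simp: sorted_wrt_append)
    then show ?thesis
      by (auto simp: transposition_product_append transpose_def intro!: transposition_product_fixes)
  qed
  obtain i j where t: "t = (i, j)" by (cases t)
  have L: "transposition_product (ts @ [t]) i = j" "i < j"
      "\<forall>x>j. transposition_product (ts @ [t]) x = x"
    using last[of ts i j] snoc.prems(1,2) unfolding t by auto
  show ?case
  proof (cases us rule: rev_cases)
    case Nil
    then show ?thesis using L snoc.prems(5) by simp
  next
    case us: (snoc us' u)
    obtain i' j' where u: "u = (i', j')" by (cases u)
    have L': "transposition_product (ts @ [t]) i' = j'" "i' < j'"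
      "\<forall>x>j'. transposition_product (ts @ [t]) x = x"
      using last[of us' i' j'] snoc.prems(3,4) unfolding snoc.prems(5) unfolding us u by auto
    have inj: "inj (transposition_product vs)" for vs
      by (induction vs) (simp_all only: transposition_product_simps inj_on_id inj_compose inj_transpose)
    \<comment> \<open>The larger of \<open>j\<close> and \<open>j'\<close> would be fixed by the
      product and also be the image of a smaller point, against injectivity.\<close>
    have "j = j'"
    proof (rule ccontr)
      assume "j \<noteq> j'"
      then consider "j < j'" | "j' < j" by linarith
      then show False
      proof cases
        case 1
        then have "transposition_product (ts @ [t]) j' = j'" using L(3) by blast
        then show False using L'(1,2) injD[OF inj, of "ts @ [t]" i' j'] by simp
      next
        case 2
        then have "transposition_product (ts @ [t]) j = j" using L'(3) by blast
        then show False using L(1,2) injD[OF inj, of "ts @ [t]" i j] by simp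
      qed
    qed
    moreover from this have "i = i'" using L(1) L'(1) injD[OF inj, of "ts @ [t]" i i'] by simp
    ultimately have tu: "t = u" using t u by simp
    have "transposition_product ts = transposition_product (ts @ [t]) \<circ> transpose i j"
      by (simp add: transposition_product_append t comp_assoc)
    also have "\<dots> = transposition_product us'"
      unfolding snoc.prems(5) us tu[symmetric]
      by (simp add: transposition_product_append t comp_assoc)
    finally have "ts = us'"
      using snoc.prems us by (intro snoc.IH) (auto simp: sorted_wrt_append)
    then show ?thesis using tu us by simp
  qed
qed

text \<open>Dropping the trivial factors from the B-code factorisation leaves a sorting
  decomposition, which by uniqueness is the one chosen by \<open>THE\<close>. The dropped factors
  contribute 0 to the sum.\<close>

lemma sorting_index_eq_sum_B_code:
  assumes p: "\<sigma> permutes {1..n}"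
  shows "sorting_index n \<sigma> = (\<Sum>i\<in>{1..n}. i - B_code n \<sigma> i)"
proof -
  let ?all = "map (\<lambda>j. (B_code n \<sigma> j, j)) [1..<Suc n]"
  let ?ts = "filter (\<lambda>(i, j). i \<noteq> j) ?all"
  have B: "1 \<le> B_code n \<sigma> j \<and> B_code n \<sigma> j \<le> j" if "j \<in> {1..n}" for j
    using B_code_in_SE[OF p] that by (auto simp: SE_def PiE_iff)
  have "sorted_wrt (<) (map snd ?ts)"
    unfolding sorted_wrt_map
    by (intro sorted_wrt_filter) (simp add: sorted_wrt_map del: upt_Suc)
  moreover have "\<forall>(i, j)\<in>set ?ts. i \<in> {1..n} \<and> j \<in> {1..n} \<and> i < j"
    using B by (fastforce simp del: upt_Suc)
  moreover have "\<sigma> = transposition_product ?ts"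
    unfolding transposition_product_drop_trivial transposition_product_B_code[OF p] ..
  ultimately have dec: "sorting_decomposition n \<sigma> ?ts"
    unfolding sorting_decomposition_def by blast
  have "(THE ts. sorting_decomposition n \<sigma> ts) = ?ts"
  proof (rule the_equality, rule dec)
    fix us assume "sorting_decomposition n \<sigma> us"
    with dec show "us = ?ts"
      unfolding sorting_decomposition_def
      by (intro transposition_product_inject) (blast, blast, blast, blast, metis)
  qed
  then have "sorting_index n \<sigma> = (\<Sum>(i, j)\<leftarrow>?ts. j - i)" by (simp add: sorting_index_def)
  also have "\<dots> = (\<Sum>(i, j)\<leftarrow>?all. j - i)"
    by (rule sum_list_map_filter) auto
  also have "\<dots> = (\<Sum>j\<leftarrow>[1..<Suc n]. j - B_code n \<sigma> j)"
    by (simp add: comp_def del: upt_Suc)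
  also have "\<dots> = (\<Sum>i\<in>{1..n}. i - B_code n \<sigma> i)"
    by (simp add: interv_sum_list_conv_sum_set_nat atLeastLessThanSuc_atLeastAtMost del: upt_Suc)
  finally show ?thesis .
qed

section \<open>The bijection\<close>

lemma bij_betw_Sym_bounded:
  assumes "bij_betw f (Sym n) (SE n)"
    and "\<And>\<sigma>. \<sigma> \<in> Sym n \<Longrightarrow> \<sigma> \<in> Sym_bounded n k \<longleftrightarrow> f \<sigma> \<in> SE_bounded n k"
  shows "bij_betw f (Sym_bounded n k) (SE_bounded n k)"
proof -
  have sub: "Sym_bounded n k \<subseteq> Sym n" "SE_bounded n k \<subseteq> f ` Sym n"
    using assms(1) by (auto simp: Sym_bounded_def SE_bounded_def bij_betw_def)
  then have "Sym_bounded n k = {\<sigma> \<in> Sym n. f \<sigma> \<in> SE_bounded n k}"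
    using assms(2) by blast
  then have "f ` Sym_bounded n k = SE_bounded n k" using sub(2) by blast
  then show ?thesis
    by (intro bij_betw_subset[OF assms(1) sub(1)])
qed

lemma bij_betw_A_code_bounded:
  assumes "n \<ge> 1"
  shows "bij_betw (A_code n) (Sym_bounded n k) (SE_bounded n k)"
proof (rule bij_betw_Sym_bounded[OF bij_betw_A_code])
  fix \<sigma> assume "\<sigma> \<in> Sym n"
  then show "\<sigma> \<in> Sym_bounded n k \<longleftrightarrow> A_code n \<sigma> \<in> SE_bounded n k"
    using Leh_bounded_iff[OF permutes_inv, of \<sigma> n k] assms
    by (simp add: Sym_bounded_iff Sym_def SE_bounded_def A_code_def Leh_in_SE)
qed

lemma bij_betw_B_code_bounded:
  assumes "n \<ge> 1"
  shows "bij_betw (B_code n) (Sym_bounded n k) (SE_bounded n k)"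
proof (rule bij_betw_Sym_bounded[OF bij_betw_B_code])
  fix \<sigma> assume "\<sigma> \<in> Sym n"
  then show "\<sigma> \<in> Sym_bounded n k \<longleftrightarrow> B_code n \<sigma> \<in> SE_bounded n k"
    using B_code_bounded_iff[of \<sigma> n k] assms
    by (simp add: Sym_bounded_iff Sym_def SE_bounded_def B_code_in_SE)
qed

text \<open>The codes have the same range \<open>SE n\<close>, so \<open>inv_into\<close> is applied
  inside the image of \<open>B_code n\<close>. Through this equation the statistics transfer from
  \<open>\<sigma>\<close> to its image.\<close>

lemma B_code_gamma_map:
  assumes "\<sigma> \<in> Sym n"
  shows "gamma_map n \<sigma> \<in> Sym n" "B_code n (gamma_map n \<sigma>) = A_code n \<sigma>"
proof -
  have "A_code n \<sigma> \<in> B_code n ` Sym n"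
    using assms bij_betw_A_code bij_betw_B_code by (metis bij_betw_imp_surj_on imageI)
  then show "gamma_map n \<sigma> \<in> Sym n" "B_code n (gamma_map n \<sigma>) = A_code n \<sigma>"
    by (simp_all add: gamma_map_def inv_into_into f_inv_into_f)
qed

theorem theorem2p8:
  fixes n k :: nat
  assumes "n \<ge> 1"
  shows "bij_betw (gamma_map n) (Sym_bounded n k) (Sym_bounded n k) \<and>
    (\<forall>\<sigma>\<in>Sym_bounded n k.
       inversion_number n \<sigma> = sorting_index n (gamma_map n \<sigma>) \<and>
       Rmil n \<sigma> = Cyc n (gamma_map n \<sigma>))"
proof (intro conjI ballI)
  have sub: "Sym_bounded n k \<subseteq> Sym n" by (auto simp: Sym_bounded_def)
  \<comment> \<open>The inverse is taken on all of \<open>Sym n\<close>; on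
    \<open>SE_bounded n k\<close> it inverts the restricted B-code.\<close>
  have "bij_betw (inv_into (Sym n) (B_code n)) (SE_bounded n k) (Sym_bounded n k)"
    using bij_betw_inv_into_subset[OF bij_betw_B_code sub]
      bij_betw_imp_surj_on[OF bij_betw_B_code_bounded[OF assms]] by blast
  then show "bij_betw (gamma_map n) (Sym_bounded n k) (Sym_bounded n k)"
    unfolding gamma_map_def by (rule bij_betw_trans[OF bij_betw_A_code_bounded[OF assms]])
  fix \<sigma> assume "\<sigma> \<in> Sym_bounded n k"
  then have \<sigma>: "\<sigma> \<in> Sym n" using sub by blast
  then have p: "\<sigma> permutes {1..n}" "gamma_map n \<sigma> permutes {1..n}"
    using B_code_gamma_map(1) by (auto simp: Sym_def)
  show "inversion_number n \<sigma> = sorting_index n (gamma_map n \<sigma>)"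
    by (simp add: inversion_number_eq_sum_A_code[OF p(1)] sorting_index_eq_sum_B_code[OF p(2)]
        B_code_gamma_map(2)[OF \<sigma>])
  show "Rmil n \<sigma> = Cyc n (gamma_map n \<sigma>)"
    by (simp add: Rmil_eq_A_code[OF p(1)] Cyc_eq_B_code[OF p(2)] B_code_gamma_map(2)[OF \<sigma>])
qed

end
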